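(* Let $M$ be a non-zero duo left $R$-module. (1) $\mathrm{Spec}^{\mathrm{fc}}(M)$ is irreducible if and only if $\mathrm{Corad}^{\mathrm{fc}}_M(M)$ is fully coprime in $M$. (2) If $M$ is self-injective, then the subset $\mathcal{S}(M)$ of $\mathrm{Spec}^{\mathrm{fc}}(M)$ is irreducible if and only if $\mathrm{Soc}(M)$ is fully coprime in $M$.
   Context: $R$ is an associative (not necessarily commutative) ring with $1_R\neq 0_R$ and modules are unital left $R$-modules; $L\leq_R M$ means that $L$ is an $R$-submodule of $M$. A submodule $L\leq_R M$ is fully invariant if $f(L)\subseteq L$ for every $R$-linear endomorphism $f$ of $M$; $M$ is duo if every $R$-submodule of $M$ is fully invariant. $M$ is self-injective if for every $N\leq_R M$ every $R$-linear map $N\to M$ extends to an endomorphism of $M$. For $X,Y\leq_R M$ put $\mathrm{An}(X)=\{f\in \mathrm{End}_R(M)\mid f(X)=0\}$ and $X\odot_M Y=\bigcap_{f\in\mathrm{An}(X)} f^{-1}(Y)$. A non-zero fully invariant submodule $K$ of $M$ is fully coprime in $M$ if for all fully invariant submodules $X,Y$ of $M$: $K\subseteq X\odot_M Y$ implies $K\subseteq X$ or $K\subseteq Y$ (in particular the zero submodule is never fully coprime in $M$). $\mathrm{Spec}^{\mathrm{fc}}(M)$ is the (possibly empty) set of all non-zero fully invariant submodules of $M$ that are fully coprime in $M$. For $L\leq_R M$ put $\mathcal{V}^{\mathrm{fc}}(L)=\{K\in\mathrm{Spec}^{\mathrm{fc}}(M)\mid K\subseteq L\}$. For $M$ duo,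 $\mathrm{Spec}^{\mathrm{fc}}(M)$ carries the topology whose closed sets are the $\mathcal{V}^{\mathrm{fc}}(L)$, $L\leq_R M$. $\mathrm{Corad}^{\mathrm{fc}}_M(M)=\sum_{K\in\mathrm{Spec}^{\mathrm{fc}}(M)}K$ ($=0$ if $\mathrm{Spec}^{\mathrm{fc}}(M)=\varnothing$). $\mathcal{S}(M)$ is the set of simple submodules of $M$ and $\mathrm{Soc}(M)=\sum_{L\in\mathcal{S}(M)}L$ ($=0$ if $\mathcal{S}(M)=\varnothing$). If $M$ is self-injective and duo, then $\mathcal{S}(M)\subseteq\mathrm{Spec}^{\mathrm{fc}}(M)$. A topological space is irreducible if it is non-empty and is not the union of two proper closed subsets; a subset of a topological space is irreducible if it is an irreducible space in the subspace topology. *)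

theory Defs
  imports "HOL-Algebra.Module" "HOL-Analysis.Abstract_Topology"
begin

text \<open>
  The locale \<open>module\<close> of HOL-Algebra requires a commutative scalar ring. The following locale
  has the same axioms over an arbitrary associative unital ring. The predicate
  \<open>submodule\<close> of HOL-Algebra does not mention commutativity of the ring and is used as it is.
\<close>

locale left_module = R?: ring + M?: abelian_group M for M (structure) +
  assumes smult_closed [simp, intro]:
      "\<lbrakk>a \<in> carrier R; x \<in> carrier M\<rbrakk> \<Longrightarrow> a \<odot>\<^bsub>M\<^esub> x \<in> carrier M"
    and smult_l_distr:
      "\<lbrakk>a \<in> carrier R; b \<in> carrier R; x \<in> carrier M\<rbrakk> \<Longrightarrow>
      (a \<oplus> b) \<odot>\<^bsub>M\<^esub> x = a \<odot>\<^bsub>M\<^esub> x \<oplus>\<^bsub>M\<^esub> b \<odot>\<^bsub>M\<^esub> x"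
    and smult_r_distr:
      "\<lbrakk>a \<in> carrier R; x \<in> carrier M; y \<in> carrier M\<rbrakk> \<Longrightarrow>
      a \<odot>\<^bsub>M\<^esub> (x \<oplus>\<^bsub>M\<^esub> y) = a \<odot>\<^bsub>M\<^esub> x \<oplus>\<^bsub>M\<^esub> a \<odot>\<^bsub>M\<^esub> y"
    and smult_assoc1:
      "\<lbrakk>a \<in> carrier R; b \<in> carrier R; x \<in> carrier M\<rbrakk> \<Longrightarrow>
      (a \<otimes> b) \<odot>\<^bsub>M\<^esub> x = a \<odot>\<^bsub>M\<^esub> (b \<odot>\<^bsub>M\<^esub> x)"
    and smult_one [simp]:
      "x \<in> carrier M \<Longrightarrow> \<one> \<odot>\<^bsub>M\<^esub> x = x"

text \<open>
  As for \<open>hom\<close> in HOL-Algebra, homomorphisms are HOL functions of which only the values on the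
  carrier matter.
\<close>

definition lmod_hom ::
  "('a, 'r) ring_scheme \<Rightarrow> ('a, 'b, 'm) module_scheme \<Rightarrow> ('a, 'c, 'n) module_scheme \<Rightarrow> ('b \<Rightarrow> 'c) set"
  where "lmod_hom R M N = {f. f ` carrier M \<subseteq> carrier N \<and>
    (\<forall>x\<in>carrier M. \<forall>y\<in>carrier M. f (x \<oplus>\<^bsub>M\<^esub> y) = f x \<oplus>\<^bsub>N\<^esub> f y) \<and>
    (\<forall>a\<in>carrier R. \<forall>x\<in>carrier M. f (a \<odot>\<^bsub>M\<^esub> x) = a \<odot>\<^bsub>N\<^esub> f x)}"

definition lmod_End :: "('a, 'r) ring_scheme \<Rightarrow> ('a, 'b, 'm) module_scheme \<Rightarrow> ('b \<Rightarrow> 'b) set"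
  where "lmod_End R M = lmod_hom R M M"

definition fully_invariant ::
  "('a, 'r) ring_scheme \<Rightarrow> ('a, 'b, 'm) module_scheme \<Rightarrow> 'b set \<Rightarrow> bool"
  where "fully_invariant R M L \<longleftrightarrow> submodule L R M \<and> (\<forall>f\<in>lmod_End R M. f ` L \<subseteq> L)"

definition duo :: "('a, 'r) ring_scheme \<Rightarrow> ('a, 'b, 'm) module_scheme \<Rightarrow> bool"
  where "duo R M \<longleftrightarrow> (\<forall>L. submodule L R M \<longrightarrow> fully_invariant R M L)"

definition self_injective :: "('a, 'r) ring_scheme \<Rightarrow> ('a, 'b, 'm) module_scheme \<Rightarrow> bool"
  where "self_injective R M \<longleftrightarrow>
    (\<forall>N g. submodule N R M \<longrightarrow> g \<in> lmod_hom R (M\<lparr>carrier := N\<rparr>) M \<longrightarrow>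
      (\<exists>f\<in>lmod_End R M. \<forall>x\<in>N. f x = g x))"

definition An :: "('a, 'r) ring_scheme \<Rightarrow> ('a, 'b, 'm) module_scheme \<Rightarrow> 'b set \<Rightarrow> ('b \<Rightarrow> 'b) set"
  where "An R M X = {f \<in> lmod_End R M. \<forall>x\<in>X. f x = \<zero>\<^bsub>M\<^esub>}"

definition internal_coproduct ::
  "('a, 'r) ring_scheme \<Rightarrow> ('a, 'b, 'm) module_scheme \<Rightarrow> 'b set \<Rightarrow> 'b set \<Rightarrow> 'b set"
  where "internal_coproduct R M X Y = (\<Inter>f\<in>An R M X. {m \<in> carrier M. f m \<in> Y})"

definition fully_coprime ::
  "('a, 'r) ring_scheme \<Rightarrow> ('a, 'b, 'm) module_scheme \<Rightarrow> 'b set \<Rightarrow> bool"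
  where "fully_coprime R M K \<longleftrightarrow> fully_invariant R M K \<and> K \<noteq> {\<zero>\<^bsub>M\<^esub>} \<and>
    (\<forall>X Y. fully_invariant R M X \<longrightarrow> fully_invariant R M Y \<longrightarrow>
      K \<subseteq> internal_coproduct R M X Y \<longrightarrow> K \<subseteq> X \<or> K \<subseteq> Y)"

definition Spec_fc :: "('a, 'r) ring_scheme \<Rightarrow> ('a, 'b, 'm) module_scheme \<Rightarrow> 'b set set"
  where "Spec_fc R M = {K. fully_coprime R M K}"

definition V_fc :: "('a, 'r) ring_scheme \<Rightarrow> ('a, 'b, 'm) module_scheme \<Rightarrow> 'b set \<Rightarrow> 'b set set"
  where "V_fc R M L = {K \<in> Spec_fc R M. K \<subseteq> L}"

text \<open>
  This is a topology only under a hypothesis such as \<open>duo R M\<close>; see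
  \<open>closedin_fc_topology\<close> and \<open>topspace_fc_topology\<close> below.
\<close>

definition fc_topology ::
  "('a, 'r) ring_scheme \<Rightarrow> ('a, 'b, 'm) module_scheme \<Rightarrow> 'b set topology"
  where "fc_topology R M =
    topology (\<lambda>U. \<exists>L. submodule L R M \<and> U = Spec_fc R M - V_fc R M L)"

text \<open>
  The sum of a family of submodules: all finite sums of elements of its members.
  It is \<open>{\<zero>}\<close> for the empty family.
\<close>

definition submodule_sum :: "('b, 'm) ring_scheme \<Rightarrow> 'b set set \<Rightarrow> 'b set"
  where "submodule_sum M \<K> =
    {finsum M x F | x F. finite F \<and> F \<subseteq> \<K> \<and> (\<forall>K\<in>F. x K \<in> K)}"

definition Corad_fc :: "('a, 'r) ring_scheme \<Rightarrow> ('a, 'b, 'm) module_scheme \<Rightarrow> 'b set"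
  where "Corad_fc R M = submodule_sum M (Spec_fc R M)"

definition simple_submodules ::
  "('a, 'r) ring_scheme \<Rightarrow> ('a, 'b, 'm) module_scheme \<Rightarrow> 'b set set"
  where "simple_submodules R M = {N. submodule N R M \<and> N \<noteq> {\<zero>\<^bsub>M\<^esub>} \<and>
    (\<forall>L. submodule L R M \<longrightarrow> L \<subseteq> N \<longrightarrow> L = {\<zero>\<^bsub>M\<^esub>} \<or> L = N)}"

definition Soc :: "('a, 'r) ring_scheme \<Rightarrow> ('a, 'b, 'm) module_scheme \<Rightarrow> 'b set"
  where "Soc R M = submodule_sum M (simple_submodules R M)"

definition irreducible_space :: "'x topology \<Rightarrow> bool"
  where "irreducible_space T \<longleftrightarrow> topspace T \<noteq> {} \<and>
    \<not> (\<exists>A B. closedin T A \<and> closedin T B \<and> A \<noteq> topspace T \<and> B \<noteq> topspace T \<and>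
      A \<union> B = topspace T)"

definition irreducible_in :: "'x topology \<Rightarrow> 'x set \<Rightarrow> bool"
  where "irreducible_in T S \<longleftrightarrow> S \<subseteq> topspace T \<and> irreducible_space (subtopology T S)"

context left_module
begin

lemma submodule_zero_mem: "submodule L R M \<Longrightarrow> \<zero>\<^bsub>M\<^esub> \<in> L"
  using subgroup.one_closed[OF submodule.axioms(1)] by fastforce

lemma submodule_sub: "submodule L R M \<Longrightarrow> L \<subseteq> carrier M"
  using subgroup.subset[OF submodule.axioms(1)] by fastforce

lemma submodule_add: "submodule L R M \<Longrightarrow> x \<in> L \<Longrightarrow> y \<in> L \<Longrightarrow> x \<oplus>\<^bsub>M\<^esub> y \<in> L"
  using subgroup.m_closed[OF submodule.axioms(1)] by fastforce

lemma submodule_minus: "submodule L R M \<Longrightarrow> x \<in> L \<Longrightarrow> \<ominus>\<^bsub>M\<^esub> x \<in> L"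
  using subgroup.m_inv_closed[OF submodule.axioms(1)] by (fastforce simp: a_inv_def)

lemma left_submoduleI:
  assumes "H \<subseteq> carrier M" "\<zero>\<^bsub>M\<^esub> \<in> H"
    and "\<And>x. x \<in> H \<Longrightarrow> \<ominus>\<^bsub>M\<^esub> x \<in> H"
    and "\<And>x y. x \<in> H \<Longrightarrow> y \<in> H \<Longrightarrow> x \<oplus>\<^bsub>M\<^esub> y \<in> H"
    and "\<And>a x. a \<in> carrier R \<Longrightarrow> x \<in> H \<Longrightarrow> a \<odot>\<^bsub>M\<^esub> x \<in> H"
  shows "submodule H R M"
  apply (intro submodule.intro subgroup.intro)
  using assms unfolding submodule_axioms_def by (simp_all add: a_inv_def)

lemma smult_zero_right: "a \<in> carrier R \<Longrightarrow> a \<odot>\<^bsub>M\<^esub> \<zero>\<^bsub>M\<^esub> = \<zero>\<^bsub>M\<^esub>"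
  by (metis M.add.r_cancel_one' M.r_zero M.zero_closed smult_closed smult_r_distr)

lemma submodule_zero: "submodule {\<zero>\<^bsub>M\<^esub>} R M"
  by (rule left_submoduleI) (auto simp: smult_zero_right)

lemma submodule_carrier: "submodule (carrier M) R M"
  by (rule left_submoduleI) auto

lemma submodule_Inter:
  assumes "\<And>L. L \<in> \<L> \<Longrightarrow> submodule L R M" "\<L> \<noteq> {}"
  shows "submodule (\<Inter>\<L>) R M"
proof (rule left_submoduleI)
  show "\<Inter>\<L> \<subseteq> carrier M"
    using assms submodule_sub by (meson Inter_lower ex_in_conv order_trans)
  show "\<zero>\<^bsub>M\<^esub> \<in> \<Inter>\<L>"
    by (simp add: assms(1) submodule_zero_mem)
  show "\<ominus>\<^bsub>M\<^esub> x \<in> \<Inter>\<L>" if "x \<in> \<Inter>\<L>" for x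
    using that by (simp add: assms(1) submodule_minus)
  show "x \<oplus>\<^bsub>M\<^esub> y \<in> \<Inter>\<L>" if "x \<in> \<Inter>\<L>" "y \<in> \<Inter>\<L>" for x y
    using that by (simp add: assms(1) submodule_add)
  show "a \<odot>\<^bsub>M\<^esub> x \<in> \<Inter>\<L>" if "a \<in> carrier R" "x \<in> \<Inter>\<L>" for a x
    using that submodule.smult_closed[OF assms(1)] by blast
qed

lemma lmod_EndD:
  assumes "f \<in> lmod_End R M"
  shows "x \<in> carrier M \<Longrightarrow> f x \<in> carrier M"
    and "x \<in> carrier M \<Longrightarrow> y \<in> carrier M \<Longrightarrow> f (x \<oplus>\<^bsub>M\<^esub> y) = f x \<oplus>\<^bsub>M\<^esub> f y"
    and "a \<in> carrier R \<Longrightarrow> x \<in> carrier M \<Longrightarrow> f (a \<odot>\<^bsub>M\<^esub> x) = a \<odot>\<^bsub>M\<^esub> f x"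
  using assms by (auto simp: lmod_End_def lmod_hom_def)

lemma lmod_End_zero:
  assumes "f \<in> lmod_End R M" shows "f \<zero>\<^bsub>M\<^esub> = \<zero>\<^bsub>M\<^esub>"
  by (metis M.add.r_cancel_one' M.l_zero M.zero_closed assms lmod_EndD(1,2))

lemma lmod_End_minus:
  assumes "f \<in> lmod_End R M" "x \<in> carrier M" shows "f (\<ominus>\<^bsub>M\<^esub> x) = \<ominus>\<^bsub>M\<^esub> f x"
  by (metis M.add.inv_closed M.l_neg M.minus_equality assms lmod_EndD(1,2) lmod_End_zero)

lemma zero_in_An: "(\<lambda>_. \<zero>\<^bsub>M\<^esub>) \<in> An R M X"
  by (auto simp: An_def lmod_End_def lmod_hom_def smult_zero_right)

lemma submodule_vimage:
  assumes f: "f \<in> lmod_End R M" and Y: "submodule Y R M"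
  shows "submodule {m \<in> carrier M. f m \<in> Y} R M"
  by (rule left_submoduleI)
    (use f Y in \<open>auto simp: lmod_EndD lmod_End_zero lmod_End_minus submodule_zero_mem
      submodule_minus submodule_add submodule.smult_closed\<close>)

lemma submodule_internal_coproduct:
  assumes "submodule Y R M"
  shows "submodule (internal_coproduct R M X Y) R M"
  unfolding internal_coproduct_def
proof (rule submodule_Inter)
  show "(\<lambda>f. {m \<in> carrier M. f m \<in> Y}) ` An R M X \<noteq> {}"
    using zero_in_An by blast
  show "submodule L R M" if "L \<in> (\<lambda>f. {m \<in> carrier M. f m \<in> Y}) ` An R M X" for L
  proof -
    from that obtain f where "f \<in> An R M X" "L = {m \<in> carrier M. f m \<in> Y}" by blast
    then show ?thesis using assms submodule_vimage by (simp add: An_def)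
  qed
qed

lemma V_fc_Un:
  assumes "duo R M" "submodule X R M" "submodule Y R M"
  shows "V_fc R M X \<union> V_fc R M Y = V_fc R M (internal_coproduct R M X Y)"
proof -
  have inv: "fully_invariant R M X" "fully_invariant R M Y"
    using assms by (auto simp: duo_def)
  have "X \<subseteq> internal_coproduct R M X Y"
    using submodule_sub[OF assms(2)] submodule_zero_mem[OF assms(3)]
    by (auto simp: internal_coproduct_def An_def)
  moreover have "Y \<subseteq> internal_coproduct R M X Y"
    using submodule_sub[OF assms(3)] inv(2)
    by (auto simp: internal_coproduct_def An_def fully_invariant_def)
  moreover have "K \<subseteq> X \<or> K \<subseteq> Y"
    if "K \<in> Spec_fc R M" "K \<subseteq> internal_coproduct R M X Y" for K
    using that inv unfolding Spec_fc_def fully_coprime_def by blast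
  ultimately show ?thesis
    unfolding V_fc_def by blast
qed

lemma V_fc_zero: "V_fc R M {\<zero>\<^bsub>M\<^esub>} = {}"
  using submodule_zero_mem
  by (auto simp: V_fc_def Spec_fc_def fully_coprime_def fully_invariant_def)

lemma V_fc_carrier: "V_fc R M (carrier M) = Spec_fc R M"
  using submodule_sub
  by (auto simp: V_fc_def Spec_fc_def fully_coprime_def fully_invariant_def)

lemma istopology_fc:
  assumes "duo R M"
  shows "istopology (\<lambda>U. \<exists>L. submodule L R M \<and> U = Spec_fc R M - V_fc R M L)"
  unfolding istopology_def
proof (intro conjI allI impI)
  fix S T
  assume "\<exists>L. submodule L R M \<and> S = Spec_fc R M - V_fc R M L"
    and "\<exists>L. submodule L R M \<and> T = Spec_fc R M - V_fc R M L"
  then obtain X Y where XY: "submodule X R M" "S = Spec_fc R M - V_fc R M X"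
      "submodule Y R M" "T = Spec_fc R M - V_fc R M Y" by blast
  then have "S \<inter> T = Spec_fc R M - V_fc R M (internal_coproduct R M X Y)"
    using V_fc_Un[OF assms XY(1,3)] by blast
  then show "\<exists>L. submodule L R M \<and> S \<inter> T = Spec_fc R M - V_fc R M L"
    using submodule_internal_coproduct XY(3) by blast
next
  fix \<K> assume K: "\<forall>K\<in>\<K>. \<exists>L. submodule L R M \<and> K = Spec_fc R M - V_fc R M L"
  define \<L> where "\<L> = insert (carrier M)
    {L. submodule L R M \<and> Spec_fc R M - V_fc R M L \<in> \<K>}"
  have "submodule (\<Inter>\<L>) R M"
    by (rule submodule_Inter) (auto simp: \<L>_def submodule_carrier)
  moreover have "\<Union>\<K> = Spec_fc R M - V_fc R M (\<Inter>\<L>)"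
  proof (intro equalityI subsetI)
    fix P assume "P \<in> \<Union>\<K>"
    then obtain U where U: "U \<in> \<K>" "P \<in> U" by blast
    with K obtain L where L: "submodule L R M" "U = Spec_fc R M - V_fc R M L" by blast
    have "L \<in> \<L>" using U(1) L by (simp add: \<L>_def)
    moreover have "\<not> P \<subseteq> L" "P \<in> Spec_fc R M" using U(2) L(2) by (auto simp: V_fc_def)
    ultimately show "P \<in> Spec_fc R M - V_fc R M (\<Inter>\<L>)"
      by (auto simp: V_fc_def)
  next
    fix P assume P: "P \<in> Spec_fc R M - V_fc R M (\<Inter>\<L>)"
    then have "\<not> P \<subseteq> \<Inter>\<L>" by (simp add: V_fc_def)
    then obtain L where L: "L \<in> \<L>" "\<not> P \<subseteq> L" by blast
    have "P \<subseteq> carrier M" using P V_fc_carrier by (auto simp: V_fc_def)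
    then have "L \<noteq> carrier M" using L(2) by blast
    then have "Spec_fc R M - V_fc R M L \<in> \<K>" using L(1) by (simp add: \<L>_def)
    moreover have "P \<in> Spec_fc R M - V_fc R M L" using P L(2) by (simp add: V_fc_def)
    ultimately show "P \<in> \<Union>\<K>" by blast
  qed
  ultimately show "\<exists>L. submodule L R M \<and> \<Union>\<K> = Spec_fc R M - V_fc R M L" by blast
qed

lemma openin_fc_topology:
  assumes "duo R M"
  shows "openin (fc_topology R M) U \<longleftrightarrow>
    (\<exists>L. submodule L R M \<and> U = Spec_fc R M - V_fc R M L)"
  unfolding fc_topology_def by (simp add: topology_inverse'[OF istopology_fc[OF assms]])

lemma topspace_fc_topology:
  assumes "duo R M"
  shows "topspace (fc_topology R M) = Spec_fc R M"
proof
  show "topspace (fc_topology R M) \<subseteq> Spec_fc R M"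
    using openin_topspace[of "fc_topology R M"] unfolding openin_fc_topology[OF assms] by blast
  have "openin (fc_topology R M) (Spec_fc R M)"
    unfolding openin_fc_topology[OF assms] using submodule_zero V_fc_zero by blast
  then show "Spec_fc R M \<subseteq> topspace (fc_topology R M)" by (rule openin_subset)
qed

lemma closedin_fc_topology:
  assumes "duo R M"
  shows "closedin (fc_topology R M) C \<longleftrightarrow> (\<exists>L. submodule L R M \<and> C = V_fc R M L)"
proof -
  have "V_fc R M L \<subseteq> Spec_fc R M" for L by (auto simp: V_fc_def)
  then show ?thesis
    unfolding closedin_def topspace_fc_topology[OF assms] openin_fc_topology[OF assms]
    by (metis Diff_Diff_Int inf.absorb_iff2)
qed

end

end

theory Submission
  imports Defs
begin

text \<open>
  Both parts are instances of one statement about an arbitrary set \<open>\<A>\<close> of fully coprime submodules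
  with sum \<open>S\<close>: the subspace \<open>\<A>\<close> is irreducible if and only if \<open>S\<close> is fully coprime
  (\<open>irreducible_in_iff_fully_coprime_submodule_sum\<close>). The reason is that \<open>S\<close> sees exactly
  which closed sets contain \<open>\<A>\<close>: since \<open>S\<close> is the least submodule above all members of \<open>\<A>\<close>,
  one has \<open>\<A> \<subseteq> V(L)\<close> if and only if \<open>S \<subseteq> L\<close>. As \<open>V(X) \<union> V(Y) = V(X \<odot> Y)\<close> over a duo module,
  the condition that \<open>\<A>\<close> is not covered by two closed sets unless one of them suffices reads
  ``\<open>S \<subseteq> X \<odot> Y\<close> implies \<open>S \<subseteq> X\<close> or \<open>S \<subseteq> Y\<close>''. Non-emptiness of \<open>\<A>\<close> corresponds to \<open>S \<noteq> 0\<close>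
  because fully coprime submodules are non-zero.

  The coradical is the case where \<open>\<A>\<close> is the whole spectrum. The socle is the case of the
  simple submodules; that these are points of the spectrum is where self-injectivity enters. If
  \<open>N\<close> is simple and not contained in \<open>X\<close>, then \<open>N \<inter> X = 0\<close>, and the projection of \<open>N + X\<close>
  onto \<open>N\<close> along \<open>X\<close> extends to an endomorphism that kills \<open>X\<close> and is the identity on \<open>N\<close>;
  this endomorphism forces \<open>N \<subseteq> Y\<close> as soon as \<open>N \<subseteq> X \<odot> Y\<close>.
\<close>

context left_module
begin

section \<open>Sums of families of submodules\<close>

lemma additive_finsum:
  assumes closed: "\<And>x. x \<in> carrier M \<Longrightarrow> \<phi> x \<in> carrier M"
    and add: "\<And>x y. x \<in> carrier M \<Longrightarrow> y \<in> carrier M \<Longrightarrow> \<phi> (x \<oplus>\<^bsub>M\<^esub> y) = \<phi> x \<oplus>\<^bsub>M\<^esub> \<phi> y"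
    and "finite F" "x \<in> F \<rightarrow> carrier M"
  shows "\<phi> (finsum M x F) = finsum M (\<lambda>i. \<phi> (x i)) F"
  using assms(3,4)
proof (induction F)
  case empty
  have "\<phi> \<zero>\<^bsub>M\<^esub> = \<zero>\<^bsub>M\<^esub>"
    by (metis M.add.r_cancel_one' M.l_zero M.zero_closed add closed)
  then show ?case by simp
next
  case (insert i F)
  then have "x i \<in> carrier M" "x \<in> F \<rightarrow> carrier M" by auto
  then have "(\<lambda>i. \<phi> (x i)) \<in> F \<rightarrow> carrier M" using closed by auto
  with insert show ?case
    by (simp add: M.finsum_insert add closed Pi_iff)
qed

lemma finsum_in_submodule:
  assumes L: "submodule L R M" and "finite F" "\<And>i. i \<in> F \<Longrightarrow> x i \<in> L"
  shows "finsum M x F \<in> L"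
  using assms(2,3)
proof (induction F)
  case empty
  show ?case using submodule_zero_mem[OF L] by simp
next
  case (insert i F)
  have "x i \<in> carrier M" "x \<in> F \<rightarrow> carrier M"
    using insert.prems submodule_sub[OF L] by auto
  with insert show ?case by (simp add: M.finsum_insert submodule_add[OF L])
qed

lemma submodule_submodule_sum:
  assumes A: "\<And>K. K \<in> \<A> \<Longrightarrow> submodule K R M"
  shows "submodule (submodule_sum M \<A>) R M"
proof -
  have sub: "x \<in> F \<rightarrow> carrier M" if "F \<subseteq> \<A>" "\<forall>K\<in>F. x K \<in> K" for x F
    using that submodule_sub[OF A] by blast
  have image: "\<phi> s \<in> submodule_sum M \<A>"
    if "s \<in> submodule_sum M \<A>" "\<And>K x. K \<in> \<A> \<Longrightarrow> x \<in> K \<Longrightarrow> \<phi> x \<in> K"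
      "\<And>x. x \<in> carrier M \<Longrightarrow> \<phi> x \<in> carrier M"
      "\<And>x y. x \<in> carrier M \<Longrightarrow> y \<in> carrier M \<Longrightarrow> \<phi> (x \<oplus>\<^bsub>M\<^esub> y) = \<phi> x \<oplus>\<^bsub>M\<^esub> \<phi> y" for \<phi> s
  proof -
    from that(1) obtain x F where F: "s = finsum M x F" "finite F" "F \<subseteq> \<A>" "\<forall>K\<in>F. x K \<in> K"
      unfolding submodule_sum_def by blast
    have "\<phi> s = finsum M (\<lambda>K. \<phi> (x K)) F"
      unfolding F(1) using that(3,4) F(2) sub[OF F(3,4)] by (rule additive_finsum)
    moreover have "\<forall>K\<in>F. \<phi> (x K) \<in> K" using F(3,4) that(2) by blast
    ultimately show ?thesis unfolding submodule_sum_def using F(2,3) by blast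
  qed
  show ?thesis
  proof (rule left_submoduleI)
    show "submodule_sum M \<A> \<subseteq> carrier M"
      unfolding submodule_sum_def using sub by (auto intro!: M.finsum_closed)
    show "\<zero>\<^bsub>M\<^esub> \<in> submodule_sum M \<A>"
      unfolding submodule_sum_def mem_Collect_eq
      by (rule exI[of _ "\<lambda>_. \<zero>\<^bsub>M\<^esub>"], rule exI[of _ "{}"]) simp
    show "\<ominus>\<^bsub>M\<^esub> s \<in> submodule_sum M \<A>" if "s \<in> submodule_sum M \<A>" for s
      using that by (rule image) (auto simp: A submodule_minus M.minus_add)
    show "a \<odot>\<^bsub>M\<^esub> s \<in> submodule_sum M \<A>" if "a \<in> carrier R" "s \<in> submodule_sum M \<A>" for a s
      using that(2) by (rule image)
        (use that(1) in \<open>auto simp: submodule.smult_closed[OF A] smult_r_distr\<close>)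
    show "s \<oplus>\<^bsub>M\<^esub> t \<in> submodule_sum M \<A>"
      if s: "s \<in> submodule_sum M \<A>" and t: "t \<in> submodule_sum M \<A>" for s t
    proof -
      from s obtain x F where F: "s = finsum M x F" "finite F" "F \<subseteq> \<A>" "\<forall>K\<in>F. x K \<in> K"
        unfolding submodule_sum_def by blast
      from t obtain y G where G: "t = finsum M y G" "finite G" "G \<subseteq> \<A>" "\<forall>K\<in>G. y K \<in> K"
        unfolding submodule_sum_def by blast
      \<comment> \<open>Extending both families by zero makes them summable over the same index set.\<close>
      define x' where "x' K = (if K \<in> F then x K else \<zero>\<^bsub>M\<^esub>)" for K
      define y' where "y' K = (if K \<in> G then y K else \<zero>\<^bsub>M\<^esub>)" for K
      have x': "\<forall>K\<in>F \<union> G. x' K \<in> K"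
        using F(3,4) G(3) submodule_zero_mem[OF A] by (auto simp: x'_def)
      have y': "\<forall>K\<in>F \<union> G. y' K \<in> K"
        using G(3,4) F(3) submodule_zero_mem[OF A] by (auto simp: y'_def)
      have FG: "F \<union> G \<subseteq> \<A>" "finite (F \<union> G)" using F G by auto
      note c = sub[OF FG(1) x'] sub[OF FG(1) y']
      have "s = finsum M x' (F \<union> G)" unfolding F(1)
      proof (rule M.add.finprod_mono_neutral_cong_left)
        show "x' \<in> F \<union> G \<rightarrow> carrier M" by (rule c(1))
      qed (simp_all add: x'_def F(2) G(2))
      moreover have "t = finsum M y' (F \<union> G)" unfolding G(1)
      proof (rule M.add.finprod_mono_neutral_cong_left)
        show "y' \<in> F \<union> G \<rightarrow> carrier M" by (rule c(2))
      qed (simp_all add: y'_def F(2) G(2))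
      ultimately have "s \<oplus>\<^bsub>M\<^esub> t = finsum M (\<lambda>K. x' K \<oplus>\<^bsub>M\<^esub> y' K) (F \<union> G)"
        using M.finsum_addf[OF c] by simp
      moreover have "\<forall>K\<in>F \<union> G. x' K \<oplus>\<^bsub>M\<^esub> y' K \<in> K"
      proof
        fix K assume K: "K \<in> F \<union> G"
        then have "submodule K R M" using FG(1) A by blast
        then show "x' K \<oplus>\<^bsub>M\<^esub> y' K \<in> K"
          using bspec[OF x' K] bspec[OF y' K] by (rule submodule_add)
      qed
      ultimately show ?thesis unfolding submodule_sum_def mem_Collect_eq using FG by blast
    qed
  qed
qed

lemma submodule_sum_subset_iff:
  assumes A: "\<And>K. K \<in> \<A> \<Longrightarrow> submodule K R M" and L: "submodule L R M"
  shows "submodule_sum M \<A> \<subseteq> L \<longleftrightarrow> (\<forall>K\<in>\<A>. K \<subseteq> L)"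
proof
  assume sum: "submodule_sum M \<A> \<subseteq> L"
  show "\<forall>K\<in>\<A>. K \<subseteq> L"
  proof (intro ballI subsetI)
    fix K k assume K: "K \<in> \<A>" "k \<in> K"
    then have "k \<in> carrier M" using submodule_sub[OF A] by blast
    then have "k = finsum M (\<lambda>_. k) {K}" by simp
    then have "k \<in> submodule_sum M \<A>"
      unfolding submodule_sum_def using K by blast
    with sum show "k \<in> L" by blast
  qed
next
  assume "\<forall>K\<in>\<A>. K \<subseteq> L"
  then show "submodule_sum M \<A> \<subseteq> L"
    unfolding submodule_sum_def by (auto intro!: finsum_in_submodule[OF L])
qed

section \<open>Irreducible subsets of the fully coprime spectrum\<close>

lemma irreducible_in_fc_topology_iff:
  assumes duo: "duo R M" and A: "\<A> \<subseteq> Spec_fc R M"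
  shows "irreducible_in (fc_topology R M) \<A> \<longleftrightarrow> \<A> \<noteq> {} \<and>
    (\<forall>X Y. submodule X R M \<longrightarrow> submodule Y R M \<longrightarrow> \<A> \<subseteq> V_fc R M X \<union> V_fc R M Y \<longrightarrow>
      \<A> \<subseteq> V_fc R M X \<or> \<A> \<subseteq> V_fc R M Y)" (is "_ \<longleftrightarrow> _ \<and> ?C")
proof -
  have top: "topspace (subtopology (fc_topology R M) \<A>) = \<A>"
    using A topspace_fc_topology[OF duo] by (simp add: inf.absorb2)
  have closed: "closedin (subtopology (fc_topology R M) \<A>) C \<longleftrightarrow>
      (\<exists>L. submodule L R M \<and> C = V_fc R M L \<inter> \<A>)" for C
    unfolding closedin_subtopology closedin_fc_topology[OF duo] by blast
  have "(\<exists>A B. (\<exists>L. submodule L R M \<and> A = V_fc R M L \<inter> \<A>) \<and>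
      (\<exists>L. submodule L R M \<and> B = V_fc R M L \<inter> \<A>) \<and> A \<noteq> \<A> \<and> B \<noteq> \<A> \<and> A \<union> B = \<A>) \<longleftrightarrow>
    (\<exists>X Y. submodule X R M \<and> submodule Y R M \<and> V_fc R M X \<inter> \<A> \<noteq> \<A> \<and> V_fc R M Y \<inter> \<A> \<noteq> \<A> \<and>
      V_fc R M X \<inter> \<A> \<union> V_fc R M Y \<inter> \<A> = \<A>)" by blast
  also have "\<dots> \<longleftrightarrow> \<not> ?C"
    by (simp add: Int_Un_distrib2[symmetric] inf.absorb_iff2[symmetric]) blast
  finally have reducible: "(\<exists>A B. (\<exists>L. submodule L R M \<and> A = V_fc R M L \<inter> \<A>) \<and>
      (\<exists>L. submodule L R M \<and> B = V_fc R M L \<inter> \<A>) \<and> A \<noteq> \<A> \<and> B \<noteq> \<A> \<and> A \<union> B = \<A>) \<longleftrightarrow> \<not> ?C" .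
  show ?thesis
    unfolding irreducible_in_def irreducible_space_def top closed reducible not_not
      topspace_fc_topology[OF duo]
    by (simp only: A simp_thms)
qed

text \<open>
  Passing from \<open>\<A>\<close> to its sum turns ``contained in the closed set of \<open>L\<close>'' into
  ``contained in \<open>L\<close>'', and irreducibility into full coprimeness.
\<close>

lemma irreducible_in_iff_fully_coprime_submodule_sum:
  assumes duo: "duo R M" and A: "\<A> \<subseteq> Spec_fc R M"
  shows "irreducible_in (fc_topology R M) \<A> \<longleftrightarrow> fully_coprime R M (submodule_sum M \<A>)"
proof -
  let ?S = "submodule_sum M \<A>"
  have sub: "submodule K R M" if "K \<in> \<A>" for K
    using A that by (auto simp: Spec_fc_def fully_coprime_def fully_invariant_def)
  have S: "submodule ?S R M" using sub by (rule submodule_submodule_sum)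
  have inv: "fully_invariant R M L \<longleftrightarrow> submodule L R M" for L
    using duo by (auto simp: duo_def fully_invariant_def)
  have V: "\<A> \<subseteq> V_fc R M L \<longleftrightarrow> ?S \<subseteq> L" if "submodule L R M" for L
    using submodule_sum_subset_iff[OF sub that] A by (auto simp: V_fc_def)
  have cover: "\<A> \<subseteq> V_fc R M X \<union> V_fc R M Y \<longleftrightarrow> ?S \<subseteq> internal_coproduct R M X Y"
    if "submodule X R M" "submodule Y R M" for X Y
    using V_fc_Un[OF duo that] V[OF submodule_internal_coproduct[OF that(2)]] by simp
  have "?S = {\<zero>\<^bsub>M\<^esub>} \<longleftrightarrow> ?S \<subseteq> {\<zero>\<^bsub>M\<^esub>}"
    using submodule_zero_mem[OF S] by blast
  also have "\<dots> \<longleftrightarrow> \<A> = {}"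
    using V[OF submodule_zero] V_fc_zero by simp
  finally show ?thesis
    unfolding irreducible_in_fc_topology_iff[OF duo A] fully_coprime_def inv
    using S V cover by auto
qed

section \<open>Simple submodules of self-injective duo modules\<close>

lemma submodule_add_set:
  assumes N: "submodule N R M" and X: "submodule X R M"
  shows "submodule {n \<oplus>\<^bsub>M\<^esub> x | n x. n \<in> N \<and> x \<in> X} R M" (is "submodule ?P R M")
proof -
  note c = subsetD[OF submodule_sub[OF N]] subsetD[OF submodule_sub[OF X]]
  show ?thesis
  proof (rule left_submoduleI)
    show "?P \<subseteq> carrier M" using c by auto
    show "\<zero>\<^bsub>M\<^esub> \<in> ?P"
      using submodule_zero_mem[OF N] submodule_zero_mem[OF X] by force
    show "\<ominus>\<^bsub>M\<^esub> z \<in> ?P" if "z \<in> ?P" for z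
      using that submodule_minus[OF N] submodule_minus[OF X] c
      by (smt (verit, best) M.minus_add mem_Collect_eq)
    show "a \<odot>\<^bsub>M\<^esub> z \<in> ?P" if "a \<in> carrier R" "z \<in> ?P" for a z
      using that submodule.smult_closed[OF N] submodule.smult_closed[OF X] c
      by (smt (verit, best) smult_r_distr mem_Collect_eq)
    fix z w assume "z \<in> ?P" "w \<in> ?P"
    then obtain n x m y where
      nx: "z = n \<oplus>\<^bsub>M\<^esub> x" "n \<in> N" "x \<in> X" and my: "w = m \<oplus>\<^bsub>M\<^esub> y" "m \<in> N" "y \<in> X" by blast
    then have "z \<oplus>\<^bsub>M\<^esub> w = (n \<oplus>\<^bsub>M\<^esub> m) \<oplus>\<^bsub>M\<^esub> (x \<oplus>\<^bsub>M\<^esub> y)"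
      using c by (simp add: M.a_ac)
    then show "z \<oplus>\<^bsub>M\<^esub> w \<in> ?P"
      using nx my submodule_add[OF N] submodule_add[OF X] by blast
  qed
qed

text \<open>
  Because the sum \<open>N + X\<close> is direct, the map \<open>n + x \<mapsto> n\<close> is well defined and linear on it;
  the endomorphism is an extension of this map.
\<close>

lemma self_injective_extends_projection:
  assumes inj: "self_injective R M"
    and N: "submodule N R M" and X: "submodule X R M" and disjoint: "N \<inter> X = {\<zero>\<^bsub>M\<^esub>}"
  obtains f where "f \<in> An R M X" "\<And>n. n \<in> N \<Longrightarrow> f n = n"
proof -
  let ?P = "{n \<oplus>\<^bsub>M\<^esub> x | n x. n \<in> N \<and> x \<in> X}"
  note c = subsetD[OF submodule_sub[OF N]] subsetD[OF submodule_sub[OF X]]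
  have unique: "n = m"
    if "n \<in> N" "x \<in> X" "m \<in> N" "y \<in> X" and eq: "n \<oplus>\<^bsub>M\<^esub> x = m \<oplus>\<^bsub>M\<^esub> y" for n x m y
  proof -
    note cc = c(1)[OF that(1)] c(2)[OF that(2)] c(1)[OF that(3)] c(2)[OF that(4)]
    have "n \<oplus>\<^bsub>M\<^esub> \<ominus>\<^bsub>M\<^esub> m = (n \<oplus>\<^bsub>M\<^esub> x) \<oplus>\<^bsub>M\<^esub> (\<ominus>\<^bsub>M\<^esub> m \<oplus>\<^bsub>M\<^esub> \<ominus>\<^bsub>M\<^esub> x)"
      using cc by (simp add: M.a_ac M.r_neg M.r_neg1 M.r_neg2)
    also have "\<dots> = (m \<oplus>\<^bsub>M\<^esub> \<ominus>\<^bsub>M\<^esub> m) \<oplus>\<^bsub>M\<^esub> (y \<oplus>\<^bsub>M\<^esub> \<ominus>\<^bsub>M\<^esub> x)"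
      unfolding eq using cc by (simp add: M.a_ac)
    also have "\<dots> = y \<oplus>\<^bsub>M\<^esub> \<ominus>\<^bsub>M\<^esub> x"
      using cc by (simp add: M.r_neg)
    finally have "n \<oplus>\<^bsub>M\<^esub> \<ominus>\<^bsub>M\<^esub> m \<in> X"
      using that submodule_add[OF X] submodule_minus[OF X] by simp
    moreover have "n \<oplus>\<^bsub>M\<^esub> \<ominus>\<^bsub>M\<^esub> m \<in> N"
      using that submodule_add[OF N] submodule_minus[OF N] by simp
    ultimately have "n \<oplus>\<^bsub>M\<^esub> \<ominus>\<^bsub>M\<^esub> m = \<zero>\<^bsub>M\<^esub>" using disjoint by blast
    then show ?thesis using cc by (metis M.minus_equality M.minus_minus M.add.inv_closed)
  qed
  define g where "g z = (THE n. n \<in> N \<and> (\<exists>x\<in>X. z = n \<oplus>\<^bsub>M\<^esub> x))" for z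
  have g: "g (n \<oplus>\<^bsub>M\<^esub> x) = n" if "n \<in> N" "x \<in> X" for n x
    unfolding g_def using that unique by (intro the_equality) blast+
  have "g \<in> lmod_hom R (M\<lparr>carrier := ?P\<rparr>) M"
    unfolding lmod_hom_def
  proof (simp, intro conjI ballI allI impI; (elim exE conjE)?)
    show "g ` ?P \<subseteq> carrier M" using g c by auto
  next
    fix z w n x m y assume "z = n \<oplus>\<^bsub>M\<^esub> x" "w = m \<oplus>\<^bsub>M\<^esub> y" and "n \<in> N" "x \<in> X" "m \<in> N" "y \<in> X"
    moreover from this have "z \<oplus>\<^bsub>M\<^esub> w = (n \<oplus>\<^bsub>M\<^esub> m) \<oplus>\<^bsub>M\<^esub> (x \<oplus>\<^bsub>M\<^esub> y)"
      using c by (simp add: M.a_ac)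
    ultimately show "g (z \<oplus>\<^bsub>M\<^esub> w) = g z \<oplus>\<^bsub>M\<^esub> g w"
      using g submodule_add[OF N] submodule_add[OF X] by simp
  next
    fix a z n x assume a: "a \<in> carrier R" and "z = n \<oplus>\<^bsub>M\<^esub> x" and "n \<in> N" "x \<in> X"
    then show "g (a \<odot>\<^bsub>M\<^esub> z) = a \<odot>\<^bsub>M\<^esub> g z"
      using g submodule.smult_closed[OF N a] submodule.smult_closed[OF X a] c
      by (simp add: smult_r_distr)
  qed
  then obtain f where f: "f \<in> lmod_End R M" "\<forall>z\<in>?P. f z = g z"
    using inj submodule_add_set[OF N X] unfolding self_injective_def by blast
  have f_sum: "f (n \<oplus>\<^bsub>M\<^esub> x) = n" if "n \<in> N" "x \<in> X" for n x
  proof -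
    have "n \<oplus>\<^bsub>M\<^esub> x \<in> ?P" using that by blast
    with f(2) have "f (n \<oplus>\<^bsub>M\<^esub> x) = g (n \<oplus>\<^bsub>M\<^esub> x)" by (rule bspec)
    then show ?thesis using g[OF that] by simp
  qed
  show ?thesis
  proof (rule that)
    show "f n = n" if "n \<in> N" for n
      using f_sum[OF that submodule_zero_mem[OF X]] c(1)[OF that] by simp
    have "f x = \<zero>\<^bsub>M\<^esub>" if "x \<in> X" for x
      using f_sum[OF submodule_zero_mem[OF N] that] c(2)[OF that] by simp
    then show "f \<in> An R M X" using f(1) by (simp add: An_def)
  qed
qed

lemma submodule_Int:
  assumes "submodule N R M" "submodule X R M"
  shows "submodule (N \<inter> X) R M"
  using submodule_Inter[of "{N, X}"] assms by auto

lemma simple_submodules_subset_Spec_fc: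
  assumes duo: "duo R M" and inj: "self_injective R M"
  shows "simple_submodules R M \<subseteq> Spec_fc R M"
proof
  fix N assume "N \<in> simple_submodules R M"
  then have N: "submodule N R M" "N \<noteq> {\<zero>\<^bsub>M\<^esub>}"
    and simple: "\<And>L. submodule L R M \<Longrightarrow> L \<subseteq> N \<Longrightarrow> L = {\<zero>\<^bsub>M\<^esub>} \<or> L = N"
    by (auto simp: simple_submodules_def)
  have "N \<subseteq> Y"
    if X: "submodule X R M" and cop: "N \<subseteq> internal_coproduct R M X Y" and "\<not> N \<subseteq> X" for X Y
  proof -
    have "N \<inter> X = {\<zero>\<^bsub>M\<^esub>}"
      using simple[OF submodule_Int[OF N(1) X]] \<open>\<not> N \<subseteq> X\<close> by blast
    then obtain f where "f \<in> An R M X" "\<And>n. n \<in> N \<Longrightarrow> f n = n"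
      using self_injective_extends_projection[OF inj N(1) X] by blast
    with cop show "N \<subseteq> Y" by (force simp: internal_coproduct_def)
  qed
  then show "N \<in> Spec_fc R M"
    using N duo by (auto simp: Spec_fc_def fully_coprime_def duo_def fully_invariant_def)
qed

end

section \<open>Irreducibility of the spectrum and of the set of simple submodules\<close>

theorem theorem3p26:
  fixes R :: "('a, 'r) ring_scheme" and M :: "('a, 'b, 'm) module_scheme"
  assumes "left_module R M"
    and "\<one>\<^bsub>R\<^esub> \<noteq> \<zero>\<^bsub>R\<^esub>"
    and "carrier M \<noteq> {\<zero>\<^bsub>M\<^esub>}"
    and "duo R M"
  shows "(irreducible_space (fc_topology R M) \<longleftrightarrow> fully_coprime R M (Corad_fc R M)) \<and>
    (self_injective R M \<longrightarrow>
      (irreducible_in (fc_topology R M) (simple_submodules R M) \<longleftrightarrow> fully_coprime R M (Soc R M)))"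
proof (intro conjI impI)
  interpret left_module R M by (rule assms(1))
  have "irreducible_space (fc_topology R M) \<longleftrightarrow> irreducible_in (fc_topology R M) (Spec_fc R M)"
    unfolding irreducible_in_def topspace_fc_topology[OF assms(4), symmetric] by simp
  then show "irreducible_space (fc_topology R M) \<longleftrightarrow> fully_coprime R M (Corad_fc R M)"
    unfolding Corad_fc_def
    using irreducible_in_iff_fully_coprime_submodule_sum[OF assms(4) order_refl] by simp
  assume "self_injective R M"
  then show "irreducible_in (fc_topology R M) (simple_submodules R M) \<longleftrightarrow> fully_coprime R M (Soc R M)"
    unfolding Soc_def
    by (intro irreducible_in_iff_fully_coprime_submodule_sum simple_submodules_subset_Spec_fc assms(4))
qed

end
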